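(* Let $r \geq 3$ and $n \geq r$ be integers, and let $\Gamma$ be an unbalanced signed graph on $n$ vertices that is $\mathcal{K}^-_{r+1}$-free, i.e., $\Gamma$ contains no unbalanced signed complete graph on $r+1$ vertices as a (signed) subgraph. Then $$\lambda_1(\Gamma) \leq \lambda_1(\Gamma_{1,r-2}),$$ with equality if and only if $\Gamma$ is switching equivalent to $\Gamma_{1,r-2}$.
   Context: A signed graph $\Gamma=(G,\sigma)$ is a simple graph $G$ together with a sign function $\sigma: E(G)\to\{-1,+1\}$. A cycle is positive if it contains an even number of negative edges and negative otherwise; $\Gamma$ is balanced if all its cycles are positive and unbalanced otherwise. $\mathcal{K}^-_{k}$ is the set of unbalanced signed complete graphs on $k$ vertices, and $\Gamma$ is $\mathcal{K}^-_{k}$-free if no subgraph of $\Gamma$ (with inherited signs) belongs to $\mathcal{K}^-_{k}$. The adjacency matrix $A(\Gamma)=(a_{ij})$ has $a_{ij}=\sigma(v_iv_j)$ if $v_i\sim v_j$ and $a_{ij}=0$ otherwise; $\lambda_1(\Gamma)$ (the index) is the largest eigenvalue of $A(\Gamma)$. For $U\subseteq V(\Gamma)$, switching with respect to $U$ reverses the signs of all edges between $U$ and $V(\Gamma)\setminus U$; two signed graphs are switching equivalent if one is obtained from the other by such a switching. $\Gamma_{1,r-2}$ denotes the signed graph on vertices $v_1,\dots,v_n$ obtained from the all-positive complete graph on $\{v_2,\dots,v_n\}$ by adding the vertex $v_1$ joined by one negative edge $v_1v_2$ and by $r-2$ positive edges $v_1v_3,\dots,v_1v_r$ (and no other edges at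 $v_1$). *)

theory Defs
  imports "Jordan_Normal_Form.Char_Poly"
begin

text \<open>A signed graph on the vertex set {0..<n} (vertices v_1,...,v_n are the indices
0,...,n-1) is represented by its adjacency function
sg i j = sigma(v_i v_j) if v_i ~ v_j and 0 otherwise.\<close>

definition signed_graph :: "nat \<Rightarrow> (nat \<Rightarrow> nat \<Rightarrow> int) \<Rightarrow> bool" where
  "signed_graph n sg \<longleftrightarrow>
     (\<forall>i j. sg i j \<in> {-1, 0, 1}) \<and>
     (\<forall>i j. sg i j = sg j i) \<and>
     (\<forall>i. sg i i = 0) \<and>
     (\<forall>i j. (i \<ge> n \<or> j \<ge> n) \<longrightarrow> sg i j = 0)"

definition adjacent :: "(nat \<Rightarrow> nat \<Rightarrow> int) \<Rightarrow> nat \<Rightarrow> nat \<Rightarrow> bool" where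
  "adjacent sg i j \<longleftrightarrow> sg i j \<noteq> 0"

definition is_cycle_in :: "(nat \<Rightarrow> nat \<Rightarrow> int) \<Rightarrow> nat set \<Rightarrow> nat list \<Rightarrow> bool" where
  "is_cycle_in sg S c \<longleftrightarrow> length c \<ge> 3 \<and> distinct c \<and> set c \<subseteq> S \<and>
     (\<forall>i < length c. adjacent sg (c ! i) (c ! ((i + 1) mod length c)))"

definition cycle_sign :: "(nat \<Rightarrow> nat \<Rightarrow> int) \<Rightarrow> nat list \<Rightarrow> int" where
  "cycle_sign sg c = (\<Prod>i<length c. sg (c ! i) (c ! ((i + 1) mod length c)))"

definition balanced_on :: "(nat \<Rightarrow> nat \<Rightarrow> int) \<Rightarrow> nat set \<Rightarrow> bool" where
  "balanced_on sg S \<longleftrightarrow> (\<forall>c. is_cycle_in sg S c \<longrightarrow> cycle_sign sg c = 1)"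

definition unbalanced :: "nat \<Rightarrow> (nat \<Rightarrow> nat \<Rightarrow> int) \<Rightarrow> bool" where
  "unbalanced n sg \<longleftrightarrow> \<not> balanced_on sg {0..<n}"

definition Kminus_free :: "nat \<Rightarrow> nat \<Rightarrow> (nat \<Rightarrow> nat \<Rightarrow> int) \<Rightarrow> bool" where
  "Kminus_free k n sg \<longleftrightarrow>
     \<not> (\<exists>S. S \<subseteq> {0..<n} \<and> card S = k \<and>
            (\<forall>i\<in>S. \<forall>j\<in>S. i \<noteq> j \<longrightarrow> adjacent sg i j) \<and>
            \<not> balanced_on sg S)"

definition adj_mat :: "nat \<Rightarrow> (nat \<Rightarrow> nat \<Rightarrow> int) \<Rightarrow> real mat" where
  "adj_mat n sg = mat n n (\<lambda>(i, j). real_of_int (sg i j))"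

definition index :: "nat \<Rightarrow> (nat \<Rightarrow> nat \<Rightarrow> int) \<Rightarrow> real" where
  "index n sg = Max {k. eigenvalue (adj_mat n sg) k}"

definition switching_equivalent ::
  "nat \<Rightarrow> (nat \<Rightarrow> nat \<Rightarrow> int) \<Rightarrow> (nat \<Rightarrow> nat \<Rightarrow> int) \<Rightarrow> bool" where
  "switching_equivalent n sg1 sg2 \<longleftrightarrow>
     (\<exists>p U. p permutes {0..<n} \<and> U \<subseteq> {0..<n} \<and>
        (\<forall>i<n. \<forall>j<n. sg1 i j =
           (if (i \<in> U) = (j \<in> U) then 1 else -1) * sg2 (p i) (p j)))"

text \<open>Gamma_{1,r-2} on n vertices: v_1 = 0, v_2 = 1, ..., v_n = n-1.
All-positive complete graph on {1..n-1}; vertex 0 joined to 1 negatively and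
to 2,...,r-1 positively.\<close>
definition Gamma1 :: "nat \<Rightarrow> nat \<Rightarrow> nat \<Rightarrow> nat \<Rightarrow> int" where
  "Gamma1 n r i j =
     (if i \<ge> n \<or> j \<ge> n \<or> i = j then 0
      else if 1 \<le> i \<and> 1 \<le> j then 1
      else if {i, j} = {0, 1} then -1
      else if (i = 0 \<and> 2 \<le> j \<and> j < r) \<or> (j = 0 \<and> 2 \<le> i \<and> i < r) then 1
      else 0)"

end

theory Submission
  imports Defs "HOL-Analysis.Function_Topology"
begin

text \<open>Write \<open>\<lambda>\<close> for the index and switch so that some eigenvector \<open>x\<close> of \<open>\<lambda>\<close> is nonnegative.
  If there is a negative triangle, extend it to a maximal clique \<open>C\<close>; as the graph is
  \<open>K\<^sup>-\<close>-free, \<open>|C| \<le> r\<close>, and every vertex outside \<open>C\<close> misses a neighbour in \<open>C\<close>.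
  Let \<open>p\<close> minimise \<open>x\<close> on \<open>C\<close>. Moving one negative edge of the triangle and one missing edge
  per outside vertex to \<open>p\<close>, and filling in everything else positively, does not decrease the
  quadratic form at \<open>x\<close>. The result is contained in a copy of \<open>\<Gamma>\<^bsub>1,r-2\<^esub>\<close>, so the bound follows
  from the Rayleigh principle; in the case of equality \<open>x\<close> is an eigenvector of both graphs, and
  comparing the two eigenvalue equations row by row identifies them.
  A negative triangle exists whenever \<open>\<lambda> \<ge> n - 2\<close>, and \<open>\<Gamma>\<^bsub>1,r-2\<^esub>\<close> contains a positive
  \<open>K\<^bsub>n-1\<^esub>\<close>, whose index is \<open>n - 2\<close>.\<close>

section \<open>Quadratic forms and eigenvalues of signed adjacency matrices\<close>

definition mulv :: "nat \<Rightarrow> (nat \<Rightarrow> nat \<Rightarrow> int) \<Rightarrow> (nat \<Rightarrow> real) \<Rightarrow> nat \<Rightarrow> real" where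
  "mulv n sg x i = (\<Sum>j<n. real_of_int (sg i j) * x j)"

definition quad :: "nat \<Rightarrow> (nat \<Rightarrow> nat \<Rightarrow> int) \<Rightarrow> (nat \<Rightarrow> real) \<Rightarrow> real" where
  "quad n sg x = (\<Sum>i<n. x i * mulv n sg x i)"

definition nsq :: "nat \<Rightarrow> (nat \<Rightarrow> real) \<Rightarrow> real" where
  "nsq n x = (\<Sum>i<n. (x i)\<^sup>2)"

lemma nsq_nonneg: "0 \<le> nsq n x"
  by (simp add: nsq_def sum_nonneg)

lemma nsq_eq_0_iff: "nsq n x = 0 \<longleftrightarrow> (\<forall>i<n. x i = 0)"
  by (auto simp: nsq_def sum_nonneg_eq_0_iff)

lemma quad_double_sum: "quad n sg x = (\<Sum>i<n. \<Sum>j<n. real_of_int (sg i j) * (x i * x j))"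
  by (simp add: quad_def mulv_def sum_distrib_left algebra_simps)

lemma quad_cong: "(\<And>i. i < n \<Longrightarrow> x i = y i) \<Longrightarrow> quad n sg x = quad n sg y"
  by (simp add: quad_double_sum)

lemma quad_scale: "quad n sg (\<lambda>i. c * x i) = c\<^sup>2 * quad n sg x"
  by (simp add: quad_double_sum sum_distrib_left power2_eq_square algebra_simps)

lemma nsq_scale: "nsq n (\<lambda>i. c * x i) = c\<^sup>2 * nsq n x"
  by (simp add: nsq_def sum_distrib_left power_mult_distrib)

lemma quad_eigen:
  assumes "\<And>i. i < n \<Longrightarrow> mulv n sg x i = k * x i"
  shows "quad n sg x = k * nsq n x"
  using assms by (simp add: quad_def nsq_def sum_distrib_left power2_eq_square algebra_simps)

text \<open>Bridge from matrix eigenvectors to functions on the naturals, of which only the values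
  below \<open>n\<close> count.\<close>

lemma eigenvalue_adj_mat_iff:
  "eigenvalue (adj_mat n sg) k \<longleftrightarrow>
     (\<exists>x. (\<exists>i<n. x i \<noteq> 0) \<and> (\<forall>i<n. mulv n sg x i = k * x i))" (is "?L \<longleftrightarrow> ?R")
proof
  assume ?L
  then obtain v where v: "v \<in> carrier_vec n" "v \<noteq> 0\<^sub>v n" "adj_mat n sg *\<^sub>v v = k \<cdot>\<^sub>v v"
    by (auto simp: eigenvalue_def eigenvector_def adj_mat_def)
  have "\<exists>i<n. v $ i \<noteq> 0"
    using v(1,2) by (metis carrier_vecD eq_vecI index_zero_vec)
  moreover have "mulv n sg (($) v) i = k * v $ i" if "i < n" for i
  proof -
    have "(adj_mat n sg *\<^sub>v v) $ i = mulv n sg (($) v) i"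
      using that v(1) by (simp add: adj_mat_def mulv_def scalar_prod_def lessThan_atLeast0)
    then show ?thesis using v that by simp
  qed
  ultimately show ?R by blast
next
  assume ?R
  then obtain x where x: "\<exists>i<n. x i \<noteq> 0" "\<And>i. i < n \<Longrightarrow> mulv n sg x i = k * x i" by blast
  define v where "v = vec n x"
  have "v \<noteq> 0\<^sub>v n" using x(1) by (auto simp: v_def vec_eq_iff)
  moreover have "adj_mat n sg *\<^sub>v v = k \<cdot>\<^sub>v v"
    using x(2) by (intro eq_vecI)
      (auto simp: v_def adj_mat_def mulv_def scalar_prod_def lessThan_atLeast0)
  ultimately show ?L
    unfolding eigenvalue_def eigenvector_def by (intro exI[of _ v]) (simp add: v_def adj_mat_def)
qed

lemma finite_eigenvalues_adj_mat: "finite {k. eigenvalue (adj_mat n sg) k}"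
proof -
  have A: "adj_mat n sg \<in> carrier_mat n n" by (simp add: adj_mat_def)
  show ?thesis
    using eigenvalue_root_char_poly[OF A] degree_monic_char_poly[OF A]
    by (auto intro: poly_roots_finite)
qed

subsection \<open>The Rayleigh principle\<close>

text \<open>Tychonoff: with the coordinates from \<open>n\<close> on pinned to 0, this copy of a
  finite-dimensional cube is a product of compact sets.\<close>

lemma compact_cube:
  "compact {x::nat \<Rightarrow> real. (\<forall>i<n. x i \<in> {-1..1}) \<and> (\<forall>i\<ge>n. x i = 0)}"
proof -
  have "compactin (product_topology (\<lambda>_. euclidean) UNIV)
          (PiE UNIV (\<lambda>i. if i < n then {-1..1::real} else {0}))"
    by (auto simp: compactin_PiE)
  moreover have "PiE UNIV (\<lambda>i. if i < n then {-1..1::real} else {0}) =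
      {x. (\<forall>i<n. x i \<in> {-1..1}) \<and> (\<forall>i\<ge>n. x i = 0)}"
    by (fastforce simp: PiE_def Pi_def split: if_splits)
  ultimately show ?thesis
    by (simp add: euclidean_product_topology)
qed

text \<open>The unit sphere is closed in the compact cube, so the form has a maximiser there;
  homogeneity of degree 2 extends the bound to all \<open>y\<close>.\<close>

lemma quad_max_exists:
  assumes "n > 0"
  shows "\<exists>x. nsq n x = 1 \<and> (\<forall>y. quad n sg y \<le> quad n sg x * nsq n y)"
proof -
  define S where
    "S = {x::nat \<Rightarrow> real. (\<forall>i<n. x i \<in> {-1..1}) \<and> (\<forall>i\<ge>n. x i = 0)} \<inter> {x. nsq n x = 1}"
  have coord: "continuous_on A (\<lambda>x::nat \<Rightarrow> real. x i)" for A i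
    by (rule continuous_on_subset[OF continuous_on_product_coordinates]) simp
  have "closed {x. nsq n x = 1}"
    unfolding nsq_def by (intro closed_Collect_eq continuous_intros coord)
  then have "compact S" unfolding S_def by (intro compact_Int_closed compact_cube)
  moreover have "(\<lambda>i. if i = 0 then 1 else 0) \<in> S"
    using assms by (auto simp: S_def nsq_def if_distrib[of "\<lambda>t. t\<^sup>2"] sum.delta cong: if_cong)
  moreover have "continuous_on S (quad n sg)"
    unfolding quad_double_sum by (intro continuous_intros coord)
  ultimately obtain x where x: "x \<in> S" "\<And>y. y \<in> S \<Longrightarrow> quad n sg y \<le> quad n sg x"
    by (metis continuous_attains_sup empty_iff)
  have "quad n sg y \<le> quad n sg x * nsq n y" for y
  proof (cases "nsq n y = 0")
    case True
    then have "quad n sg y = 0" by (simp add: nsq_eq_0_iff quad_def)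
    then show ?thesis using True by simp
  next
    case False
    then have pos: "nsq n y > 0" using nsq_nonneg[of n y] by linarith
    define c where "c = 1 / sqrt (nsq n y)"
    have c2: "c\<^sup>2 * nsq n y = 1" using pos by (simp add: c_def power_divide)
    define z where "z = (\<lambda>i. if i < n then c * y i else 0)"
    have nz: "nsq n z = 1"
      using nsq_scale[of n c y] c2 by (simp add: z_def nsq_def)
    have "\<bar>z i\<bar> \<le> 1" if "i < n" for i
    proof -
      have "(z i)\<^sup>2 \<le> nsq n z"
        unfolding nsq_def using that by (intro member_le_sum) auto
      then show ?thesis using nz by (simp add: abs_square_le_1)
    qed
    then have "z \<in> S" using nz by (force simp: S_def z_def abs_le_iff)
    then have "quad n sg z \<le> quad n sg x" by (rule x(2))
    moreover have "quad n sg z = c\<^sup>2 * quad n sg y"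
      using quad_cong[of n z "\<lambda>i. c * y i"] by (simp add: z_def quad_scale)
    ultimately have "c\<^sup>2 * quad n sg y * nsq n y \<le> quad n sg x * nsq n y"
      using pos by (simp add: mult_right_mono)
    moreover have "c\<^sup>2 * quad n sg y * nsq n y = quad n sg y"
      using c2 by (metis mult.assoc mult.commute mult_1)
    ultimately show ?thesis by simp
  qed
  then show ?thesis using x(1) by (auto simp: S_def)
qed

text \<open>First variation of the nonnegative form \<open>k |x|\<^sup>2 - quad x\<close> at a zero, along the basis
  direction \<open>i\<close>.\<close>
lemma eigen_if_maximal:
  assumes sym: "\<And>i j. sg i j = sg j i"
    and le: "\<And>y. quad n sg y \<le> k * nsq n y"
    and eq: "quad n sg x = k * nsq n x" and i: "i < n"
  shows "mulv n sg x i = k * x i"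
proof -
  define g where "g = k * x i - mulv n sg x i"
  define c where "c = k - real_of_int (sg i i)"
  have F: "k * nsq n (\<lambda>j. x j + (if j = i then t else 0)) - quad n sg (\<lambda>j. x j + (if j = i then t else 0))
       = 2 * t * g + t\<^sup>2 * c" for t
  proof -
    define e where "e = (\<lambda>j. if j = i then t else (0::real))"
    have e: "(\<Sum>j<n. f j * e j) = f i * t" for f
      using i by (simp add: e_def if_distrib[of "\<lambda>t. _ * t"] sum.delta' cong: if_cong)
    have N: "nsq n (\<lambda>j. x j + e j) = nsq n x + 2 * t * x i + t\<^sup>2"
    proof -
      have "nsq n (\<lambda>j. x j + e j) = nsq n x + 2 * (\<Sum>j<n. x j * e j) + (\<Sum>j<n. e j * e j)"
        by (simp add: nsq_def power2_eq_square algebra_simps sum.distrib sum_distrib_left)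
      also have "(\<Sum>j<n. e j * e j) = t\<^sup>2" using e[of e] by (simp add: e_def power2_eq_square)
      finally show ?thesis using e[of x] by simp
    qed
    have M: "mulv n sg (\<lambda>j. x j + e j) l = mulv n sg x l + real_of_int (sg l i) * t" for l
      by (simp add: mulv_def ring_distribs sum.distrib e)
    have "quad n sg (\<lambda>j. x j + e j)
        = (\<Sum>l<n. x l * mulv n sg x l) + t * (\<Sum>l<n. real_of_int (sg l i) * x l)
          + (\<Sum>l<n. mulv n sg x l * e l) + t * (\<Sum>l<n. real_of_int (sg l i) * e l)"
      unfolding quad_def M by (simp add: algebra_simps sum.distrib sum_distrib_left)
    also have "(\<Sum>l<n. real_of_int (sg l i) * x l) = mulv n sg x i"
      unfolding mulv_def by (simp add: sym[of _ i])
    finally have Q: "quad n sg (\<lambda>j. x j + e j)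
        = quad n sg x + 2 * t * mulv n sg x i + t\<^sup>2 * real_of_int (sg i i)"
      by (simp add: e quad_def power2_eq_square)
    show ?thesis using N Q eq unfolding e_def g_def c_def by (simp add: algebra_simps)
  qed
  have nn: "0 \<le> 2 * t * g + t\<^sup>2 * c" for t
    using le[of "\<lambda>j. x j + (if j = i then t else 0)"] F[of t] by linarith
  have "g = 0"
  proof (rule ccontr)
    assume "g \<noteq> 0"
    \<comment> \<open>The choice \<open>t = - g / d\<close> makes the linear term win: the variation
      becomes a positive multiple of \<open>c - 2 * d\<close>, which is negative.\<close>
    define d where "d = \<bar>c\<bar> + 1"
    have d: "d > 0" "c < d" by (auto simp: d_def)
    have "0 \<le> (2 * (- g / d) * g + (- g / d)\<^sup>2 * c) * d\<^sup>2"
      using nn[of "- g / d"] by (intro mult_nonneg_nonneg) simp_all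
    also have "\<dots> = g\<^sup>2 * (c - 2 * d)"
      using d by (simp add: field_simps power2_eq_square)
    also have "\<dots> < 0" using \<open>g \<noteq> 0\<close> d by (intro mult_pos_neg) auto
    finally show False by simp
  qed
  then show ?thesis by (simp add: g_def)
qed

text \<open>The maximal Rayleigh quotient is an eigenvalue by first variation, and each eigenvalue
  is the Rayleigh quotient of its eigenvector; so the maximum is the index.\<close>

lemma index_properties:
  assumes "n > 0" and sym: "\<And>i j. sg i j = sg j i"
  shows quad_le_index: "quad n sg y \<le> index n sg * nsq n y"
    and index_eigenvector:
      "\<exists>x. (\<exists>i<n. x i \<noteq> 0) \<and> (\<forall>i<n. mulv n sg x i = index n sg * x i)"
proof -
  obtain x where "nsq n x = 1 \<and> (\<forall>y. quad n sg y \<le> quad n sg x * nsq n y)"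
    using quad_max_exists[OF assms(1)] ..
  then have x: "nsq n x = 1" and max: "\<forall>y. quad n sg y \<le> quad n sg x * nsq n y"
    by (blast, blast)
  define k where "k = quad n sg x"
  have eig: "mulv n sg x i = k * x i" if "i < n" for i
  proof (rule eigen_if_maximal[OF _ _ _ that])
    show "sg i j = sg j i" for i j by (rule sym)
    show "quad n sg y \<le> k * nsq n y" for y using max unfolding k_def by blast
    show "quad n sg x = k * nsq n x" by (simp add: x k_def)
  qed
  have nz: "\<exists>i<n. x i \<noteq> 0" using x nsq_eq_0_iff[of n x] by auto
  have "l \<le> k" if l: "eigenvalue (adj_mat n sg) l" for l
  proof -
    obtain z where z: "\<exists>i<n. z i \<noteq> 0" "\<forall>i<n. mulv n sg z i = l * z i"
      using l unfolding eigenvalue_adj_mat_iff by blast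
    have "nsq n z > 0" using z(1) nsq_nonneg[of n z] nsq_eq_0_iff[of n z] by force
    moreover have "l * nsq n z \<le> k * nsq n z"
      using max[rule_format, of z] quad_eigen[of n sg z l] z(2) by (simp add: k_def)
    ultimately show ?thesis by simp
  qed
  moreover have "eigenvalue (adj_mat n sg) k"
    unfolding eigenvalue_adj_mat_iff using eig nz by blast
  ultimately have "index n sg = k"
    unfolding index_def by (intro Max_eqI finite_eigenvalues_adj_mat) auto
  then show "quad n sg y \<le> index n sg * nsq n y"
    and "\<exists>x. (\<exists>i<n. x i \<noteq> 0) \<and> (\<forall>i<n. mulv n sg x i = index n sg * x i)"
    using max eig nz by (auto simp: k_def)
qed

subsection \<open>Switching\<close>

text \<open>Switching composed with relabelling is conjugation by a signed permutation matrix; every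
  sign enters squared.\<close>

lemma quad_switch:
  assumes p: "p permutes {..<n}" and s: "\<And>i. s i = 1 \<or> s i = (-1::int)"
    and a: "\<And>i j. i < n \<Longrightarrow> j < n \<Longrightarrow> a i j = s i * s j * b (p i) (p j)"
  shows "quad n a (\<lambda>i. real_of_int (s i) * y (p i)) = quad n b y"
    and "nsq n (\<lambda>i. real_of_int (s i) * y (p i)) = nsq n y"
proof -
  have s2: "(real_of_int (s i))\<^sup>2 = 1" for i
    using s[of i] by auto
  have "real_of_int (a i j) * (real_of_int (s i) * y (p i) * (real_of_int (s j) * y (p j)))
      = real_of_int (b (p i) (p j)) * (y (p i) * y (p j))" if "i < n" "j < n" for i j
  proof -
    have "real_of_int (a i j) * (real_of_int (s i) * y (p i) * (real_of_int (s j) * y (p j)))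
        = (real_of_int (s i))\<^sup>2 * (real_of_int (s j))\<^sup>2
          * (real_of_int (b (p i) (p j)) * (y (p i) * y (p j)))"
      by (simp add: a[OF that] power2_eq_square)
    then show ?thesis by (simp add: s2)
  qed
  then have "quad n a (\<lambda>i. real_of_int (s i) * y (p i))
      = (\<Sum>i<n. \<Sum>j<n. real_of_int (b (p i) (p j)) * (y (p i) * y (p j)))"
    unfolding quad_double_sum by (intro sum.cong refl) simp
  also have "\<dots> = (\<Sum>i<n. \<Sum>j<n. real_of_int (b (p i) j) * (y (p i) * y j))"
    by (intro sum.cong[OF refl]
        sum.permute[OF p, of "\<lambda>j. real_of_int (b (p _) j) * (y (p _) * y j)", unfolded o_def, symmetric])
  also have "\<dots> = (\<Sum>i<n. \<Sum>j<n. real_of_int (b i j) * (y i * y j))"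
    by (simp add: sum.permute[OF p, of "\<lambda>i. \<Sum>j<n. real_of_int (b i j) * (y i * y j)"] o_def)
  finally show "quad n a (\<lambda>i. real_of_int (s i) * y (p i)) = quad n b y"
    by (simp add: quad_double_sum)
  have "nsq n (\<lambda>i. real_of_int (s i) * y (p i)) = (\<Sum>i<n. (y (p i))\<^sup>2)"
    by (simp add: nsq_def power_mult_distrib s2)
  then show "nsq n (\<lambda>i. real_of_int (s i) * y (p i)) = nsq n y"
    by (simp add: nsq_def sum.permute[OF p, of "\<lambda>i. (y i)\<^sup>2"] o_def)
qed

lemma index_mono:
  assumes "n > 0" and "\<And>i j. a i j = a j i" and "\<And>i j. b i j = b j i"
    and le: "\<And>x. \<exists>y. quad n a x \<le> quad n b y \<and> nsq n y = nsq n x"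
  shows "index n a \<le> index n b"
proof -
  obtain x where x: "\<exists>i<n. x i \<noteq> 0" "\<forall>i<n. mulv n a x i = index n a * x i"
    using index_eigenvector[OF assms(1), of a] assms(2) by blast
  obtain y where y: "quad n a x \<le> quad n b y" "nsq n y = nsq n x" using le by blast
  have "index n a * nsq n x \<le> index n b * nsq n x"
    using quad_eigen[of n a x "index n a"] x(2) y quad_le_index[OF assms(1), of b y] assms(3) by auto
  moreover have "nsq n x > 0" using x(1) nsq_nonneg[of n x] nsq_eq_0_iff[of n x] by force
  ultimately show ?thesis by simp
qed

lemma index_switching_equivalent:
  assumes "n > 0" and "\<And>i j. a i j = a j i" and "\<And>i j. b i j = b j i"
    and "switching_equivalent n a b"
  shows "index n a = index n b"
proof -
  obtain p U where p: "p permutes {0..<n}"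
    and ab: "\<forall>i<n. \<forall>j<n. a i j = (if (i \<in> U) = (j \<in> U) then 1 else -1) * b (p i) (p j)"
    using assms(4) unfolding switching_equivalent_def by blast
  define s where "s i = (if i \<in> U then -1 else (1::int))" for i
  have p': "p permutes {..<n}" using p by (simp add: lessThan_atLeast0)
  have s: "s i = 1 \<or> s i = -1" for i by (simp add: s_def)
  have ab': "a i j = s i * s j * b (p i) (p j)" if "i < n" "j < n" for i j
    using ab that by (simp add: s_def)
  note q = quad_switch[of p n s a b, OF p' s ab']
  have "\<exists>y. quad n a x \<le> quad n b y \<and> nsq n y = nsq n x" for x
  proof -
    define y where "y j = real_of_int (s (inv_into UNIV p j)) * x (inv_into UNIV p j)" for j
    have "(\<lambda>i. real_of_int (s i) * y (p i)) = x"
    proof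
      fix i show "real_of_int (s i) * y (p i) = x i"
        using s[of i] by (auto simp: y_def permutes_inverses[OF p])
    qed
    then show ?thesis using q[of y] by auto
  qed
  moreover have "\<exists>y. quad n b x \<le> quad n a y \<and> nsq n y = nsq n x" for x
    using q[of x] by (metis order_refl)
  ultimately show ?thesis
    using index_mono[OF assms(1,2,3)] index_mono[OF assms(1,3,2)] by (simp add: order_antisym)
qed

section \<open>Cycle signs and negative triangles\<close>

lemma prod_cyclic_shift:
  fixes f :: "nat \<Rightarrow> 'a::comm_monoid_mult"
  shows "(\<Prod>i<m. f ((i + 1) mod m)) = (\<Prod>i<m. f i)"
proof (cases m)
  case (Suc k)
  have "(\<Prod>i<Suc k. f ((i + 1) mod Suc k)) = (\<Prod>i<k. f (Suc i)) * f 0" by simp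
  then show ?thesis by (simp add: Suc prod.lessThan_Suc_shift mult.commute del: prod.lessThan_Suc)
qed simp

text \<open>Without a negative edge after switching, every nonzero \<open>sg i j\<close> equals
  \<open>s i * s j\<close>. Around a cycle each vertex sign then occurs twice, so all cycles would
  be positive.\<close>

lemma unbalanced_negative_edge:
  assumes "signed_graph n sg" and "unbalanced n sg" and s: "\<And>i. s i = 1 \<or> s i = (-1::int)"
  shows "\<exists>i<n. \<exists>j<n. s i * s j * sg i j = -1"
proof (rule ccontr)
  assume no: "\<not> ?thesis"
  have sgn: "sg i j \<in> {-1, 0, 1}" for i j using assms(1) by (simp add: signed_graph_def)
  have pos: "sg i j = s i * s j" if "i < n" "j < n" "sg i j \<noteq> 0" for i j
  proof -
    have "s i * s j * sg i j \<noteq> -1" using no that by blast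
    moreover have "sg i j = 1 \<or> sg i j = -1" using sgn[of i j] that by blast
    ultimately show ?thesis using s[of i] s[of j] by auto
  qed
  have "cycle_sign sg c = 1" if c: "is_cycle_in sg {0..<n} c" for c
  proof -
    let ?m = "length c"
    have "cycle_sign sg c = (\<Prod>i<?m. s (c ! i) * s (c ! ((i + 1) mod ?m)))"
      unfolding cycle_sign_def
    proof (intro prod.cong refl)
      fix i assume "i \<in> {..<?m}"
      then have i: "i < ?m" "(i + 1) mod ?m < ?m" by (auto intro: mod_less_divisor)
      then have "c ! i < n" "c ! ((i + 1) mod ?m) < n"
        using subsetD[OF _ nth_mem[OF i(1)]] subsetD[OF _ nth_mem[OF i(2)]] c
        unfolding is_cycle_in_def by (metis atLeastLessThan_iff)+
      then show "sg (c ! i) (c ! ((i + 1) mod ?m)) = s (c ! i) * s (c ! ((i + 1) mod ?m))"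
        using pos c i(1) by (simp add: is_cycle_in_def adjacent_def)
    qed
    also have "\<dots> = (\<Prod>i<?m. s (c ! i) * s (c ! i))"
      by (simp add: prod.distrib prod_cyclic_shift[of "\<lambda>i. s (c ! i)", simplified])
    also have "\<dots> = 1" using s by (intro prod.neutral ballI) (metis mult_1 mult_minus1 minus_minus)
    finally show ?thesis .
  qed
  then show False using assms(2) by (simp add: unbalanced_def balanced_on_def)
qed

lemma negative_triangle_unbalanced:
  assumes "signed_graph n sg" and "{u, v, w} \<subseteq> S" and neg: "sg u v * sg v w * sg w u = -1"
  shows "\<not> balanced_on sg S" and "card {u, v, w} = 3"
proof -
  have nz: "sg u v \<noteq> 0" "sg v w \<noteq> 0" "sg w u \<noteq> 0" using neg by auto
  then have d: "u \<noteq> v" "v \<noteq> w" "w \<noteq> u"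
    using assms(1) by (auto simp: signed_graph_def)
  then show "card {u, v, w} = 3" by auto
  have "adjacent sg ([u, v, w] ! i) ([u, v, w] ! ((i + 1) mod 3))" if "i < 3" for i
  proof -
    have "i = 0 \<or> i = 1 \<or> i = 2" using that by linarith
    then show ?thesis by (elim disjE) (simp_all add: nz adjacent_def)
  qed
  then have "is_cycle_in sg S [u, v, w]"
    using d assms(2) by (simp add: is_cycle_in_def)
  moreover have "cycle_sign sg [u, v, w] = -1"
  proof -
    have "cycle_sign sg [u, v, w] = (\<Prod>i\<in>{0, 1, 2}. sg ([u, v, w] ! i) ([u, v, w] ! ((i + 1) mod 3)))"
      unfolding cycle_sign_def by (intro prod.cong) auto
    then show ?thesis using neg by (simp add: mult.assoc)
  qed
  ultimately show "\<not> balanced_on sg S" unfolding balanced_on_def by force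
qed

text \<open>A larger clique would contain \<open>r + 1\<close> vertices including the triangle, and
  these span a forbidden unbalanced complete graph.\<close>

lemma Kminus_free_clique_card:
  assumes sg: "signed_graph n sg" and free: "Kminus_free (r + 1) n sg" and r: "r \<ge> 3"
    and C: "C \<subseteq> {..<n}" "\<And>i j. i \<in> C \<Longrightarrow> j \<in> C \<Longrightarrow> i \<noteq> j \<Longrightarrow> sg i j \<noteq> 0"
    and uvw: "{u, v, w} \<subseteq> C" "sg u v * sg v w * sg w u = -1"
  shows "card C \<le> r"
proof (rule ccontr)
  assume "\<not> card C \<le> r"
  moreover have "finite C" using C(1) finite_subset by blast
  ultimately obtain S where S: "{u, v, w} \<subseteq> S" "S \<subseteq> C" "card S = r + 1"
    using exists_subset_between[of "{u, v, w}" "r + 1" C] uvw(1) r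
      negative_triangle_unbalanced(2)[OF sg uvw] by auto
  have "\<not> balanced_on sg S" using negative_triangle_unbalanced(1)[OF sg S(1) uvw(2)] .
  moreover have "S \<subseteq> {0..<n}" using S(2) C(1) by auto
  moreover have "\<forall>i\<in>S. \<forall>j\<in>S. i \<noteq> j \<longrightarrow> adjacent sg i j"
    using S(2) C(2) by (auto simp: adjacent_def)
  ultimately show False using free S(3) unfolding Kminus_free_def by blast
qed

subsection \<open>Copies of the extremal graph\<close>

text \<open>A copy of \<open>Gamma1\<close> with free centre \<open>p\<close> and negative neighbour
  \<open>q\<close>. It is used with distinct \<open>p\<close>, \<open>q\<close> in \<open>D\<close>,
  which is then the closed neighbourhood of the centre.\<close>

definition star :: "nat \<Rightarrow> nat \<Rightarrow> nat \<Rightarrow> nat set \<Rightarrow> nat \<Rightarrow> nat \<Rightarrow> int" where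
  "star n p q D i j =
     (if i \<ge> n \<or> j \<ge> n \<or> i = j then 0
      else if i \<noteq> p \<and> j \<noteq> p then 1
      else if {i, j} = {p, q} then -1
      else if i \<in> D \<and> j \<in> D then 1 else 0)"

lemma star_sym: "star n p q D i j = star n p q D j i"
  by (auto simp: star_def insert_commute)

lemma Gamma1_sym: "Gamma1 n r i j = Gamma1 n r j i"
  by (auto simp: Gamma1_def insert_commute)

lemma star_Gamma1:
  assumes D: "D \<subseteq> {..<n}" "card D = r" and pq: "p \<in> D" "q \<in> D" "p \<noteq> q"
  shows "\<exists>\<pi>. \<pi> permutes {0..<n} \<and>
    (\<forall>i<n. \<forall>j<n. star n p q D i j = Gamma1 n r (\<pi> i) (\<pi> j))"
proof -
  have fin: "finite D" using D(1) finite_subset by blast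
  have "card {p, q} \<le> card D" using pq by (intro card_mono fin) auto
  then have r2: "2 \<le> r" using pq D by simp
  have rn: "r \<le> n" using card_mono[OF _ D(1)] D(2) by simp
  have "card (D - {p, q}) = card {2..<r}" using pq D(2) fin by (simp add: card_Diff_subset)
  then obtain f where f: "bij_betw f (D - {p, q}) {2..<r}"
    using finite_same_card_bij fin by (metis finite_Diff finite_atLeastLessThan)
  have "card ({..<n} - D) = card {r..<n}" using D fin by (simp add: card_Diff_subset)
  then obtain g where g: "bij_betw g ({..<n} - D) {r..<n}"
    using finite_same_card_bij by (metis finite_Diff finite_atLeastLessThan finite_lessThan)
  \<comment> \<open>The centre goes to 0, its negative neighbour to 1, the other vertices of
    \<open>D\<close> fill the block up to \<open>r - 1\<close>, and the remaining vertices
    follow.\<close>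
  define \<pi> where
    "\<pi> i = (if i = p then 0 else if i = q then 1 else if i \<in> D then f i else if i < n then g i else i)" for i
  have fr: "2 \<le> f i" "f i < r" if "i \<in> D" "i \<noteq> p" "i \<noteq> q" for i
    using bij_betwE[OF f] that by auto
  have gr: "r \<le> g i" "g i < n" if "i \<notin> D" "i < n" for i
    using bij_betwE[OF g] that by auto
  have fi: "f i = f j \<longleftrightarrow> i = j" if "i \<in> D" "i \<noteq> p" "i \<noteq> q" "j \<in> D" "j \<noteq> p" "j \<noteq> q" for i j
    using inj_on_eq_iff[OF bij_betw_imp_inj_on[OF f], of i j] that by simp
  have gi: "g i = g j \<longleftrightarrow> i = j" if "i \<notin> D" "i < n" "j \<notin> D" "j < n" for i j
    using inj_on_eq_iff[OF bij_betw_imp_inj_on[OF g], of i j] that by simp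
  \<comment> \<open>The preimages of 0, of 1 and of the numbers below \<open>r\<close> decide every
    case of \<open>Gamma1\<close>.\<close>
  have p0: "\<pi> i = 0 \<longleftrightarrow> i = p" if "i < n" for i
    using fr[of i] gr[of i] r2 that pq by (auto simp: \<pi>_def)
  have q1: "\<pi> i = 1 \<longleftrightarrow> i = q" if "i < n" for i
    using fr[of i] gr[of i] r2 that pq by (auto simp: \<pi>_def)
  have Dr: "\<pi> i < r \<longleftrightarrow> i \<in> D" if "i < n" for i
    using fr[of i] gr[of i] r2 that pq by (auto simp: \<pi>_def)
  have lt: "\<pi> i < n" if "i < n" for i
    using fr[of i] gr[of i] r2 rn that by (auto simp: \<pi>_def)
  have inj: "\<pi> i = \<pi> j \<longleftrightarrow> i = j" if ij: "i < n" "j < n" for i j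
  proof
    assume eq: "\<pi> i = \<pi> j"
    show "i = j"
    proof (cases "i \<in> {p, q} \<or> j \<in> {p, q}")
      case True
      then show ?thesis using eq p0[OF ij(1)] p0[OF ij(2)] q1[OF ij(1)] q1[OF ij(2)] by auto
    next
      case False
      moreover have "i \<in> D \<longleftrightarrow> j \<in> D" using eq Dr[OF ij(1)] Dr[OF ij(2)] by simp
      ultimately show ?thesis using eq fi[of i j] gi[of i j] ij by (cases "i \<in> D") (simp_all add: \<pi>_def)
    qed
  qed simp
  have "inj_on \<pi> {0..<n}" using inj by (auto simp: inj_on_def)
  moreover have "\<pi> ` {0..<n} \<subseteq> {0..<n}" using lt by auto
  ultimately have "bij_betw \<pi> {0..<n} {0..<n}"
    by (simp add: bij_betw_def endo_inj_surj)
  then have "\<pi> permutes {0..<n}"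
    using D(1) pq by (intro bij_imp_permutes) (auto simp: \<pi>_def)
  moreover have "star n p q D i j = Gamma1 n r (\<pi> i) (\<pi> j)" if ij: "i < n" "j < n" for i j
  proof -
    have ge1: "1 \<le> \<pi> k \<longleftrightarrow> k \<noteq> p" "2 \<le> \<pi> k \<longleftrightarrow> k \<noteq> p \<and> k \<noteq> q" if "k < n" for k
      using p0[OF that] q1[OF that] by auto
    show ?thesis
      using ij pq lt[OF ij(1)] lt[OF ij(2)] p0[OF ij(1)] p0[OF ij(2)] q1[OF ij(1)] q1[OF ij(2)]
        Dr[OF ij(1)] Dr[OF ij(2)] ge1[OF ij(1)] ge1[OF ij(2)] inj[OF ij]
      by (auto simp: star_def Gamma1_def doubleton_eq_iff)
  qed
  ultimately show ?thesis by blast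
qed

text \<open>The indicator vector of the all-positive clique on the vertices other than 0 has
  Rayleigh quotient \<open>n - 2\<close>.\<close>

lemma Gamma1_index_ge:
  assumes "r \<ge> 3" and "n \<ge> r"
  shows "real n - 2 \<le> index n (Gamma1 n r)"
proof -
  obtain m where m: "n = Suc m" using assms by (cases n) auto
  define x where "x i = (if i = 0 then 0 else 1::real)" for i :: nat
  have "real_of_int (Gamma1 n r (Suc i) (Suc j)) = 1 - (if j = i then 1 else 0)"
    if "i < m" "j < m" for i j
    using that m by (simp add: Gamma1_def)
  then have "quad n (Gamma1 n r) x = (\<Sum>i<m. \<Sum>j<m. 1 - (if j = i then 1 else 0))"
    unfolding quad_double_sum m sum.lessThan_Suc_shift by (simp add: x_def)
  also have "\<dots> = (\<Sum>i<m. real m - 1)"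
    by (intro sum.cong refl) (simp add: sum_subtractf sum.delta)
  also have "\<dots> = (real n - 2) * real m" by (simp add: m algebra_simps)
  finally have "(real n - 2) * real m \<le> index n (Gamma1 n r) * nsq n x"
    using quad_le_index[of n "Gamma1 n r" x] Gamma1_sym assms by simp
  moreover have "nsq n x = real m"
    unfolding nsq_def m sum.lessThan_Suc_shift by (simp add: x_def)
  moreover have "m > 0" using m assms by simp
  ultimately show ?thesis by simp
qed

subsection \<open>Comparing penalties\<close>

text \<open>\<open>pen D v w c\<close> collects what a graph with the negative edge \<open>vw\<close> and the missing edges
  \<open>z (c z)\<close> for \<open>z \<notin> D\<close> loses at least, compared with the all-positive complete graph.\<close>
definition pen :: "nat set \<Rightarrow> nat \<Rightarrow> nat \<Rightarrow> (nat \<Rightarrow> nat) \<Rightarrow> nat \<Rightarrow> nat \<Rightarrow> real" where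
  "pen D v w c i j =
     (if i = v then if j = w then 2 else 0 else 0) + (if i = w then if j = v then 2 else 0 else 0)
     + (if j = c i then if i \<notin> D then 1 else 0 else 0)
     + (if i = c j then if j \<notin> D then 1 else 0 else 0)"

text \<open>Each penalised edge is met in both orders: the negative edge costs 2 each time, a
  missing edge 1 each time.\<close>

lemma pen_sum:
  assumes "v < n" "w < n" and c: "\<And>z. z < n \<Longrightarrow> z \<notin> D \<Longrightarrow> c z < n"
  shows "(\<Sum>i<n. \<Sum>j<n. pen D v w c i j * (x i * x j))
     = 4 * (x v * x w) + 2 * (\<Sum>z\<in>{..<n} - D. x z * x (c z))"
proof -
  have delta: "(\<Sum>j<n. (if j = b then k else 0) * f j) = k * f b" if "b < n" for b k and f :: "nat \<Rightarrow> real"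
  proof -
    have "(\<Sum>j<n. (if j = b then k else 0) * f j) = (\<Sum>j<n. if j = b then k * f j else 0)"
      by (intro sum.cong refl) simp
    then show ?thesis using that by simp
  qed
  have edge: "(\<Sum>i<n. \<Sum>j<n. (if i = a then if j = b then 2 else 0 else 0) * (x i * x j)) = 2 * (x a * x b)"
    if "a < n" "b < n" for a b
  proof -
    have "(\<Sum>j<n. (if i = a then if j = b then 2 else 0 else 0) * (x i * x j))
        = (if i = a then 2 else 0) * (x i * x b)" for i
      using delta[OF that(2), of 2 "\<lambda>j. x i * x j"] by (cases "i = a") auto
    then show ?thesis using delta[OF that(1), of 2 "\<lambda>i. x i * x b"] by simp
  qed
  have row: "(\<Sum>j<n. (if j = c i then if i \<notin> D then 1 else 0 else 0) * (x i * x j))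
      = (if i \<notin> D then x i * x (c i) else 0)" if "i < n" for i
    using c[OF that] delta[of "c i" 1 "\<lambda>j. x i * x j"] by simp
  have out: "(\<Sum>i<n. if i \<notin> D then x i * x (c i) else 0) = (\<Sum>z\<in>{..<n} - D. x z * x (c z))"
    by (rule sum.mono_neutral_cong_right) auto
  have miss: "(\<Sum>i<n. \<Sum>j<n. (if j = c i then if i \<notin> D then 1 else 0 else 0) * (x i * x j))
      = (\<Sum>z\<in>{..<n} - D. x z * x (c z))"
    using row out by simp
  have miss': "(\<Sum>i<n. \<Sum>j<n. (if i = c j then if j \<notin> D then 1 else 0 else 0) * (x i * x j))
      = (\<Sum>z\<in>{..<n} - D. x z * x (c z))"
    by (subst sum.swap) (use miss in \<open>simp add: mult.commute\<close>)
  show ?thesis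
    unfolding pen_def distrib_right sum.distrib miss miss' edge[OF assms(1,2)] edge[OF assms(2,1)]
    by (simp add: mult.commute)
qed

text \<open>\<open>D\<close> only pads the clique \<open>C\<close> to exactly \<open>r\<close> vertices, and \<open>c z\<close> is a vertex of \<open>C\<close> not
  adjacent to \<open>z\<close>. The star is centred at \<open>p\<close> with negative edge \<open>p q\<close>.\<close>
locale maximal_clique =
  fixes n r :: nat and b :: "nat \<Rightarrow> nat \<Rightarrow> int" and x :: "nat \<Rightarrow> real"
    and C D :: "nat set" and c :: "nat \<Rightarrow> nat" and u v w p q :: nat
  assumes b: "signed_graph n b"
    and x_nonneg: "\<And>i. i < n \<Longrightarrow> 0 \<le> x i"
    and CD: "C \<subseteq> D" "D \<subseteq> {..<n}" "card D = r"
    and triangle: "u \<in> C" "v \<in> C" "w \<in> C" "b u v * b v w * b w u = -1" and vw: "b v w = -1"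
    and c: "\<And>z. z < n \<Longrightarrow> z \<notin> C \<Longrightarrow> c z \<in> C" "\<And>z. z < n \<Longrightarrow> z \<notin> C \<Longrightarrow> b z (c z) = 0"
    and p: "p \<in> C" "\<And>i. i \<in> C \<Longrightarrow> x p \<le> x i"
    and q: "q \<in> {v, w}" "q \<noteq> p" "p \<in> {v, w} \<Longrightarrow> {p, q} = {v, w}"
begin

lemma b_le_1: "b i j \<le> 1"
proof -
  have "b i j \<in> {-1, 0, 1}" using b by (simp add: signed_graph_def)
  then show ?thesis by auto
qed

lemma b_sym: "b i j = b j i"
  using b by (simp add: signed_graph_def)

lemma b_diag: "b i i = 0"
  using b by (simp add: signed_graph_def)

lemma C_lt: "i \<in> C \<Longrightarrow> i < n" and D_lt: "i \<in> D \<Longrightarrow> i < n" and q_C: "q \<in> C"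
  using CD q(1) triangle by auto

lemma triangle_distinct: "u \<noteq> v" "v \<noteq> w" "w \<noteq> u"
  using triangle(4) b_diag by auto

text \<open>The penalties never overlap, since \<open>v\<close>, \<open>w\<close> and the chosen
  \<open>c z\<close> lie in \<open>D\<close> while \<open>z\<close> does not. Off the diagonal,
  unpenalised entries need only \<open>b i j \<le> 1\<close>.\<close>

lemma b_le_pen:
  assumes "i < n" "j < n"
  shows "real_of_int (b i j) \<le> (if i = j then 0 else 1) - pen D v w c i j"
proof (cases "i = j")
  case True
  have "c i \<noteq> i \<or> i \<in> D" using c(1)[of i] CD(1) assms by (metis subsetD)
  then show ?thesis using True triangle_distinct b_diag by (auto simp: pen_def)
next
  case ne: False
  have vwD: "v \<in> D" "w \<in> D" using triangle CD by auto
  have cD: "c z \<in> D" "b z (c z) = 0" "b (c z) z = 0" if "z < n" "z \<notin> D" for z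
    using c[of z] that CD(1) b_sym[of z "c z"] by auto
  consider "i \<notin> D" "j = c i" | "j \<notin> D" "i = c j" | "{i, j} = {v, w}"
    | "\<not> (i \<notin> D \<and> j = c i)" "\<not> (j \<notin> D \<and> i = c j)" "{i, j} \<noteq> {v, w}" by blast
  then show ?thesis
  proof cases
    case 1
    then show ?thesis using cD[OF assms(1)] vwD ne by (auto simp: pen_def)
  next
    case 2
    then show ?thesis using cD[OF assms(2)] vwD ne by (auto simp: pen_def)
  next
    case 3
    then have "(i, j) = (v, w) \<or> (i, j) = (w, v)" by (simp add: doubleton_eq_iff)
    moreover have "pen D v w c v w = 2" "pen D v w c w v = 2"
      using vwD triangle_distinct by (auto simp: pen_def)
    ultimately show ?thesis using vw b_sym[of v w] triangle_distinct by auto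
  next
    case 4
    then have "pen D v w c i j = 0" by (auto simp: pen_def)
    then show ?thesis using ne b_le_1[of i j] by simp
  qed
qed

text \<open>For the star the penalties are exact: it differs from the positive complete graph only
  in the edge \<open>p q\<close> and in the missing edges from \<open>p\<close> to vertices outside
  \<open>D\<close>.\<close>

lemma star_eq_pen:
  assumes "i < n" "j < n"
  shows "real_of_int (star n p q D i j) = (if i = j then 0 else 1) - pen D p q (\<lambda>_. p) i j"
proof -
  have "p \<in> D" "q \<in> D" using p q_C CD by auto
  then show ?thesis using assms q(2) by (auto simp: star_def pen_def doubleton_eq_iff)
qed

lemma sum_complete_pen:
  "(\<Sum>i<n. \<Sum>j<n. ((if i = j then 0 else 1) - pen D v' w' c' i j) * (x i * x j))
    = (\<Sum>i<n. \<Sum>j<n. (if i = j then 0 else 1) * (x i * x j))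
      - (\<Sum>i<n. \<Sum>j<n. pen D v' w' c' i j * (x i * x j))"
  by (simp only: left_diff_distrib sum_subtractf)

text \<open>As \<open>x p\<close> is minimal on \<open>C\<close>, moving all losses to edges at \<open>p\<close> does not increase them.\<close>
lemma quad_le_star: "quad n b x \<le> quad n (star n p q D) x"
proof -
  have "quad n b x \<le> (\<Sum>i<n. \<Sum>j<n. ((if i = j then 0 else 1) - pen D v w c i j) * (x i * x j))"
    unfolding quad_double_sum
    by (intro sum_mono mult_right_mono b_le_pen mult_nonneg_nonneg x_nonneg) auto
  moreover have "quad n (star n p q D) x
      = (\<Sum>i<n. \<Sum>j<n. ((if i = j then 0 else 1) - pen D p q (\<lambda>_. p) i j) * (x i * x j))"
    unfolding quad_double_sum by (intro sum.cong refl) (simp add: star_eq_pen)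
  moreover have "(\<Sum>i<n. \<Sum>j<n. pen D p q (\<lambda>_. p) i j * (x i * x j))
      \<le> (\<Sum>i<n. \<Sum>j<n. pen D v w c i j * (x i * x j))"
  proof -
    have cC: "c z \<in> C" if "z < n" "z \<notin> D" for z using c(1) that CD(1) by blast
    \<comment> \<open>If \<open>p\<close> lies on the edge \<open>v w\<close>, both edges coincide;
      otherwise the endpoint other than \<open>q\<close> is replaced by \<open>p\<close>, whose
      entry is no larger.\<close>
    have "x p * x q \<le> x v * x w"
    proof (cases "p \<in> {v, w}")
      case True
      then show ?thesis using q(3) by (auto simp: doubleton_eq_iff mult.commute)
    next
      case False
      have "x p * x v \<le> x w * x v" "x p * x w \<le> x v * x w"
        using p(2) triangle x_nonneg C_lt by (auto intro: mult_right_mono)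
      then show ?thesis using q(1) by (auto simp: mult.commute)
    qed
    moreover have "(\<Sum>z\<in>{..<n} - D. x z * x p) \<le> (\<Sum>z\<in>{..<n} - D. x z * x (c z))"
      using p(2) cC x_nonneg by (intro sum_mono mult_left_mono) auto
    moreover have "v < n" "w < n" "p < n" "q < n" using C_lt triangle p q_C by auto
    ultimately show ?thesis
      using C_lt cC by (simp add: pen_sum)
  qed
  ultimately show ?thesis by (simp add: sum_complete_pen)
qed

text \<open>Away from column \<open>p\<close> the star row is as large as possible, and
  \<open>le\<close> covers column \<open>p\<close>. Both rows have the same product with the
  positive vector \<open>x\<close>, so no entry can be strictly smaller.\<close>

lemma row_eq_star:
  assumes "i < n" "i \<noteq> p" and pos: "\<And>i. i < n \<Longrightarrow> 0 < x i"
    and eig: "mulv n b x i = k * x i" "mulv n (star n p q D) x i = k * x i"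
    and le: "b i p \<le> star n p q D i p" and "j < n"
  shows "b i j = star n p q D i j"
proof -
  have le': "b i l \<le> star n p q D i l" if "l < n" for l
    using le b_le_1[of i l] b_diag assms(1,2) that by (cases "l = p") (auto simp: star_def)
  have "(\<Sum>l<n. (real_of_int (star n p q D i l) - real_of_int (b i l)) * x l) = 0"
    using eig by (simp add: mulv_def left_diff_distrib sum_subtractf)
  then have "\<forall>l\<in>{..<n}. (real_of_int (star n p q D i l) - real_of_int (b i l)) * x l = 0"
    using le' x_nonneg by (subst (asm) sum_nonneg_eq_0_iff) auto
  then have "(real_of_int (star n p q D i j) - real_of_int (b i j)) * x j = 0"
    using \<open>j < n\<close> by blast
  then show ?thesis using pos[OF \<open>j < n\<close>] by simp
qed

lemma eq_star_if_rows:
  assumes "\<And>i j. i < n \<Longrightarrow> j < n \<Longrightarrow> i \<noteq> p \<Longrightarrow> b i j = star n p q D i j"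
    and "i < n" "j < n"
  shows "b i j = star n p q D i j"
  using assms b_diag by (metis b_sym star_sym star_def)

text \<open>The rows are treated in an order that makes the comparison in column \<open>p\<close>
  available: first \<open>D\<close> without \<open>p\<close> and \<open>q\<close>, then
  \<open>q\<close>, then the vertices outside \<open>D\<close>.\<close>

lemma eq_star_if_pos:
  assumes pos: "\<And>i. i < n \<Longrightarrow> 0 < x i"
    and eig: "\<And>i. i < n \<Longrightarrow> mulv n b x i = k * x i"
      "\<And>i. i < n \<Longrightarrow> mulv n (star n p q D) x i = k * x i"
    and ij: "i < n" "j < n"
  shows "b i j = star n p q D i j"
proof (rule eq_star_if_rows[OF _ ij])
  have pD: "p \<in> D" "q \<in> D" "p < n" "q < n" using p q_C CD by auto
  note row = row_eq_star[OF _ _ pos eig]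
  \<comment> \<open>In these rows the star has 1 in column \<open>p\<close>, so the comparison there
    is automatic.\<close>
  have rowD: "b i j = 1" if "i \<in> D" "i \<noteq> p" "i \<noteq> q" "j < n" "i \<noteq> j" for i j
  proof -
    have "star n p q D i p = 1" "star n p q D i j = 1"
      using that pD D_lt[OF that(1)] by (auto simp: star_def doubleton_eq_iff)
    then show ?thesis using row[of i j] b_le_1[of i p] that D_lt by simp
  qed
  \<comment> \<open>Otherwise \<open>v\<close> or \<open>w\<close> differs from both
    \<open>p\<close> and \<open>q\<close>, and its row of ones contradicts the negative
    edge.\<close>
  have "p \<in> {v, w}"
  proof (rule ccontr)
    assume "p \<notin> {v, w}"
    moreover have "\<exists>i\<in>{v, w}. i \<noteq> q" using triangle_distinct by auto
    moreover have "b v w = -1" "b w v = -1" using vw b_sym[of v w] by auto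
    ultimately show False
      using rowD[of v w] rowD[of w v] triangle triangle_distinct CD(1) C_lt by auto
  qed
  then have pq: "b q p = -1"
    using q(3) vw b_sym[of v w] by (auto simp: doubleton_eq_iff)
  have rowq: "b q j = 1" if "j < n" "j \<noteq> p" "j \<noteq> q" for j
  proof -
    have "star n p q D q p = -1" "star n p q D q j = 1"
      using that pD q(2) by (auto simp: star_def doubleton_eq_iff)
    then show ?thesis using row[of q j] pq that D_lt pD q(2) by simp
  qed
  fix i j assume ij: "i < n" "j < n" "i \<noteq> p"
  have "b i p \<le> star n p q D i p"
  proof (cases "i \<in> D")
    case True
    then show ?thesis using pq b_le_1[of i p] ij pD by (auto simp: star_def doubleton_eq_iff)
  next
    case False
    then have cz: "c i \<in> C" "b i (c i) = 0" "b (c i) i = 0"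
      using c[of i] ij(1) CD(1) b_sym[of i "c i"] by auto
    \<comment> \<open>Every vertex of \<open>D\<close> other than \<open>p\<close> is by now
      adjacent to \<open>i\<close>, so the non-neighbour \<open>c i\<close> is \<open>p\<close>,
      where the star row vanishes too.\<close>
    then have "c i = p"
      using rowD[of "c i" i] rowq[of i] ij False CD(1) pD by (metis subsetD zero_neq_one)
    then show ?thesis using cz False ij pD by (auto simp: star_def doubleton_eq_iff)
  qed
  then show "b i j = star n p q D i j" using row ij by blast
qed

text \<open>The degenerate eigenvector \<open>x = 1 - e\<^sub>p\<close>: row \<open>p\<close> of the star then forces \<open>r = 3\<close>.\<close>
lemma eq_star_if_zero:
  assumes x: "x p = 0" "\<And>i. i < n \<Longrightarrow> i \<noteq> p \<Longrightarrow> x i = 1"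
    and complete: "\<And>i j. i < n \<Longrightarrow> j < n \<Longrightarrow> i \<noteq> p \<Longrightarrow> j \<noteq> p \<Longrightarrow> i \<noteq> j \<Longrightarrow> b i j = 1"
    and eig: "mulv n (star n p q D) x p = k * x p"
    and ij: "i < n" "j < n"
  shows "b i j = star n p q D i j"
proof (rule eq_star_if_rows[OF _ ij])
  have pD: "p \<in> D" "q \<in> D" "p < n" "q < n" using p q_C CD by auto
  have fin: "finite D" using CD(2) finite_subset by blast
  have vwn: "v < n" "w < n" "u < n" using triangle C_lt by auto
  have pvw: "p \<in> {v, w}"
    using complete[OF vwn(1,2)] vw triangle_distinct by auto
  then have pq: "b p q = -1"
    using q(3) vw b_sym[of v w] by (auto simp: doubleton_eq_iff)
  \<comment> \<open>Two edges of the negative triangle are known, one of each sign, so the third is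
    positive.\<close>
  have up: "b p u = 1"
  proof -
    have "b q u = 1" using complete[of q u] pvw q vwn triangle_distinct by auto
    then show ?thesis
      using pvw q triangle(4) pq b_sym[of u v] b_sym[of u w] b_sym[of p q] b_sym[of v w]
      by (auto simp: doubleton_eq_iff)
  qed
  \<comment> \<open>Since \<open>x p = 0\<close>, the one negative entry of row \<open>p\<close> is
    cancelled by exactly one positive entry; the corresponding vertex must be \<open>u\<close>, so
    \<open>D\<close> is the triangle itself.\<close>
  have "0 = (\<Sum>j<n. real_of_int (star n p q D p j) * x j)"
    using eig x(1) by (simp add: mulv_def)
  also have "\<dots> = (\<Sum>j\<in>D - {p}. real_of_int (star n p q D p j) * x j)"
    using CD(2) pD by (intro sum.mono_neutral_right) (auto simp: star_def doubleton_eq_iff)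
  also have "\<dots> = (\<Sum>j\<in>D - {p}. if j = q then -1 else 1)"
    using CD(2) pD q(2) x(2) by (intro sum.cong refl) (auto simp: star_def doubleton_eq_iff)
  also have "\<dots> = -1 + (\<Sum>j\<in>D - {p} - {q}. 1)"
    using pD q(2) fin by (subst sum.remove[of _ q]) auto
  finally have "card (D - {p} - {q}) = 1" by simp
  then obtain t where t: "D - {p} - {q} = {t}" by (auto simp: card_1_singleton_iff)
  have "u \<in> D - {p} - {q}" using triangle triangle_distinct CD(1) pvw q(1) by auto
  then have D: "D = {p, q, u}" using t pD by auto
  have C: "C = D" using D CD(1) p(1) q_C triangle(1) by auto
  fix i j assume ij: "i < n" "j < n" "i \<noteq> p"
  show "b i j = star n p q D i j"
  proof (cases "j = p")
    case jp: True
    show ?thesis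
    proof (cases "i \<in> D")
      case True
      then show ?thesis
        using jp pq up b_sym[of p i] ij pD D q(2) by (auto simp: star_def doubleton_eq_iff)
    next
      case False
      then have "b i (c i) = 0" "c i \<in> D" using c[of i] C ij(1) by auto
      then have "c i = p" using complete[of i "c i"] ij False D_lt by force
      then show ?thesis
        using \<open>b i (c i) = 0\<close> jp False ij pD by (auto simp: star_def doubleton_eq_iff)
    qed
  next
    case False
    then show ?thesis using complete ij b_diag by (auto simp: star_def)
  qed
qed

end

text \<open>An inclusion-maximal clique through the triangle works: maximality provides
  \<open>c\<close>, the bound on cliques leaves room for the padding \<open>D\<close>, and
  finiteness gives the minimiser \<open>p\<close>.\<close>

lemma maximal_clique_exists:
  assumes b: "signed_graph n b" and x: "\<And>i. i < n \<Longrightarrow> 0 \<le> x i" and "r \<le> n"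
    and free: "\<And>C u v w. C \<subseteq> {..<n} \<Longrightarrow> (\<And>i j. i \<in> C \<Longrightarrow> j \<in> C \<Longrightarrow> i \<noteq> j \<Longrightarrow> b i j \<noteq> 0)
      \<Longrightarrow> {u, v, w} \<subseteq> C \<Longrightarrow> b u v * b v w * b w u = -1 \<Longrightarrow> card C \<le> r"
    and tri: "u < n" "v < n" "w < n" "b u v * b v w * b w u = -1"
  shows "\<exists>C D c u v w p q. maximal_clique n r b x C D c u v w p q"
proof -
  have sym: "b i j = b j i" and diag: "b i i = 0" and val: "b i j \<in> {-1, 0, 1}" for i j
    using b by (simp_all add: signed_graph_def)
  \<comment> \<open>A product -1 has a negative factor; rotating the triangle brings it to the edge
    \<open>v' w'\<close>.\<close>
  obtain u' v' w' where t: "{u', v', w'} = {u, v, w}" "b u' v' * b v' w' * b w' u' = -1" "b v' w' = -1"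
  proof -
    consider "b v w = -1" | "b u v = -1" | "b w u = -1"
      using tri(4) val[of u v] val[of v w] val[of w u] by auto
    then show thesis
    proof cases
      case 1 then show ?thesis using that[of u v w] tri(4) by simp
    next
      case 2 then show ?thesis using that[of w u v] tri(4) by (simp add: insert_commute mult.commute)
    next
      case 3 then show ?thesis using that[of v w u] tri(4) by (simp add: insert_commute mult.commute)
    qed
  qed
  define cliques where
    "cliques = {C. C \<subseteq> {..<n} \<and> {u', v', w'} \<subseteq> C \<and> (\<forall>i\<in>C. \<forall>j\<in>C. i \<noteq> j \<longrightarrow> b i j \<noteq> 0)}"
  have "b u' v' \<noteq> 0" "b v' w' \<noteq> 0" "b w' u' \<noteq> 0" using t(2) by auto
  then have "\<forall>i\<in>{u', v', w'}. \<forall>j\<in>{u', v', w'}. i \<noteq> j \<longrightarrow> b i j \<noteq> 0" using sym by (metis insertE singletonD)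
  moreover have "{u', v', w'} \<subseteq> {..<n}" unfolding t(1) using tri by simp
  ultimately have "{u', v', w'} \<in> cliques" by (simp add: cliques_def)
  moreover have "finite cliques"
    by (rule finite_subset[of _ "Pow {..<n}"]) (auto simp: cliques_def)
  ultimately obtain C where C: "C \<in> cliques" "\<And>C'. C' \<in> cliques \<Longrightarrow> C \<subseteq> C' \<Longrightarrow> C' = C"
    using finite_has_maximal[of cliques] by (metis empty_iff)
  then have Cn: "C \<subseteq> {..<n}" and uvwC: "{u', v', w'} \<subseteq> C"
    and clique: "\<And>i j. i \<in> C \<Longrightarrow> j \<in> C \<Longrightarrow> i \<noteq> j \<Longrightarrow> b i j \<noteq> 0"
    by (auto simp: cliques_def)
  have finC: "finite C" using Cn finite_subset by blast
  have "\<exists>y\<in>C. b z y = 0" if "z < n" "z \<notin> C" for z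
  proof (rule ccontr)
    assume "\<not> ?thesis"
    then have "\<forall>y\<in>C. b z y \<noteq> 0 \<and> b y z \<noteq> 0" using sym by metis
    then have "insert z C \<in> cliques" using Cn uvwC clique that by (auto simp: cliques_def)
    then show False using C(2)[of "insert z C"] that by blast
  qed
  then obtain c where c: "\<And>z. z < n \<Longrightarrow> z \<notin> C \<Longrightarrow> c z \<in> C" "\<And>z. z < n \<Longrightarrow> z \<notin> C \<Longrightarrow> b z (c z) = 0"
    by metis
  have "card C \<le> r" using free[OF Cn clique uvwC t(2)] .
  then obtain D where D: "C \<subseteq> D" "D \<subseteq> {..<n}" "card D = r"
    using exists_subset_between[of C r "{..<n}"] Cn \<open>r \<le> n\<close> by auto
  have "C \<noteq> {}" using uvwC by auto
  then obtain p where p: "p \<in> C" "\<And>i. i \<in> C \<Longrightarrow> x p \<le> x i"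
    using ex_min_if_finite[of "x ` C"] finC by (metis arg_min_if_finite(1) arg_min_least)
  have "v' \<noteq> w'" using t(3) diag by auto
  \<comment> \<open>\<open>q\<close> is the other endpoint if \<open>p\<close> lies on the negative
    edge, and either endpoint if it does not.\<close>
  then obtain q where q: "q \<in> {v', w'}" "q \<noteq> p" "p \<in> {v', w'} \<Longrightarrow> {p, q} = {v', w'}"
    by (metis insertE insertI1 insert_commute singletonD)
  have "maximal_clique n r b x C D c u' v' w' p q"
    by unfold_locales (use b x D uvwC t(2,3) c p q in auto)
  then show ?thesis by blast
qed

subsection \<open>Large index\<close>

text \<open>At a vertex \<open>u\<close> where the eigenvector is maximal, the row sum of \<open>1 - b u j x j\<close> is
  \<open>n - 1 - k \<le> 1\<close>, so there is room for at most one vertex with \<open>b u w x w \<le> 0\<close>.\<close>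
locale large_index =
  fixes n :: nat and b :: "nat \<Rightarrow> nat \<Rightarrow> int" and x :: "nat \<Rightarrow> real" and k :: real
  assumes b: "signed_graph n b" and x: "\<And>i. i < n \<Longrightarrow> 0 \<le> x i" "\<And>i. i < n \<Longrightarrow> x i \<le> 1"
    and eig: "\<And>i. i < n \<Longrightarrow> mulv n b x i = k * x i" and large: "real n - 2 \<le> k"
begin

lemma b_sym: "b i j = b j i"
  using b by (simp add: signed_graph_def)

lemma b_diag: "b i i = 0"
  using b by (simp add: signed_graph_def)

lemma b_cases: obtains "b i j = -1" | "b i j = 0" | "b i j = 1"
proof -
  have "b i j \<in> {-1, 0, 1}" using b by (simp add: signed_graph_def)
  then show thesis using that by auto
qed

lemma bx_le_1: "j < n \<Longrightarrow> real_of_int (b i j) * x j \<le> 1"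
  using x[of j] by (cases rule: b_cases[of i j]) auto

lemma max_row:
  assumes u: "u < n" "x u = 1" and w: "w < n" "w \<noteq> u" "real_of_int (b u w) * x w \<le> 0"
  shows "real_of_int (b u w) * x w = 0"
    and "j < n \<Longrightarrow> j \<noteq> u \<Longrightarrow> j \<noteq> w \<Longrightarrow> b u j = 1 \<and> x j = 1"
proof -
  let ?f = "\<lambda>j. 1 - real_of_int (b u j) * x j"
  have "(\<Sum>j<n. ?f j) = real n - k"
    using eig[OF u(1)] u(2) by (simp add: sum_subtractf mulv_def)
  moreover have "(\<Sum>j<n. ?f j) = ?f u + (?f w + (\<Sum>j\<in>{..<n} - {u} - {w}. ?f j))"
    using u w by (subst sum.remove[of _ u], simp, simp, subst sum.remove[of _ w]) auto
  moreover have "?f u = 1" by (simp add: b_diag)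
  moreover have nn: "0 \<le> (\<Sum>j\<in>{..<n} - {u} - {w}. ?f j)"
    using bx_le_1 by (intro sum_nonneg) auto
  \<comment> \<open>The total \<open>n - k\<close> is at most 2; \<open>u\<close> takes 1 and
    \<open>w\<close> at least 1, so nothing is left for the other vertices.\<close>
  ultimately have *: "real_of_int (b u w) * x w = 0" "(\<Sum>j\<in>{..<n} - {u} - {w}. ?f j) = 0"
    using large w(3) by linarith+
  then show "real_of_int (b u w) * x w = 0" by simp
  have "\<forall>j\<in>{..<n} - {u} - {w}. ?f j = 0"
    using *(2) bx_le_1 by (subst (asm) sum_nonneg_eq_0_iff) auto
  moreover assume j: "j < n" "j \<noteq> u" "j \<noteq> w"
  ultimately have "real_of_int (b u j) * x j = 1" by simp
  then show "b u j = 1 \<and> x j = 1"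
    using x(1)[OF j(1)] by (cases rule: b_cases[of u j]) auto
qed

text \<open>The zero makes \<open>w\<close> the exceptional vertex of row \<open>u\<close>, so all
  other entries are 1; then \<open>max_row\<close> applies to each of those vertices in place of
  \<open>u\<close>.\<close>

lemma zero_entry:
  assumes u: "u < n" "x u = 1" and w: "w < n" "x w = 0"
  shows "j < n \<Longrightarrow> j \<noteq> w \<Longrightarrow> x j = 1"
    and "i < n \<Longrightarrow> j < n \<Longrightarrow> i \<noteq> w \<Longrightarrow> j \<noteq> w \<Longrightarrow> i \<noteq> j \<Longrightarrow> b i j = 1"
proof -
  have one: "x j = 1" if "j < n" "j \<noteq> w" for j
    using max_row(2)[OF u w(1), of j] u w that by fastforce
  then show "j < n \<Longrightarrow> j \<noteq> w \<Longrightarrow> x j = 1" .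
  assume "i < n" "j < n" "i \<noteq> w" "j \<noteq> w" "i \<noteq> j"
  then show "b i j = 1" using max_row(2)[of i w j] one w by simp
qed

text \<open>A negative edge avoiding the exceptional vertex \<open>w\<close> of row \<open>u\<close>
  closes a negative triangle with \<open>u\<close>. If it meets \<open>w\<close>, the eigenvalue
  equation at \<open>w\<close> supplies the third vertex.\<close>

lemma negative_triangle_exists:
  assumes u: "u < n" "x u = 1" and neg: "i < n" "j < n" "b i j = -1"
  shows "\<exists>a<n. \<exists>c<n. \<exists>d<n. b a c * b c d * b d a = -1"
proof (cases "\<exists>w<n. w \<noteq> u \<and> real_of_int (b u w) * x w \<le> 0")
  case False
  have pos: "b u l = 1" if "l < n" "l \<noteq> u" for l
  proof -
    have "\<not> real_of_int (b u l) * x l \<le> 0" using False that by blast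
    then show ?thesis using x(1)[OF that(1)] by (cases rule: b_cases[of u l]) auto
  qed
  have "i \<noteq> j" using neg(3) b_diag by auto
  then have "i \<noteq> u" "j \<noteq> u" using pos[of i] pos[of j] neg b_sym[of i u] by auto
  then have "b u i * b i j * b j u = -1" using pos neg b_sym[of j u] by simp
  then show ?thesis using u neg by blast
next
  case True
  then obtain w where w: "w < n" "w \<noteq> u" "real_of_int (b u w) * x w \<le> 0" by blast
  note R = max_row(2)[OF u w]
  show ?thesis
  proof (cases "i = w \<or> j = w")
    case False
    have "i \<noteq> j" using neg(3) b_diag by auto
    then have "i \<noteq> u" "j \<noteq> u" using R[of i] R[of j] neg b_sym[of i u] False by auto
    then have "b u i * b i j * b j u = -1" using R neg b_sym[of j u] False by simp
    then show ?thesis using u neg by blast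
  next
    case True
    then obtain l where l: "l < n" "b w l = -1"
      using neg b_sym[of i j] by auto
    have lw: "l \<noteq> w" using l b_diag by auto
    have xl: "x l = 1" using R[of l] u l lw by (cases "l = u") auto
    have blw: "b l w = -1" using l(2) b_sym by simp
    have le: "real_of_int (b l w) * x w \<le> 0" using blw x(1)[OF w(1)] by simp
    \<comment> \<open>\<open>l\<close> is a maximal vertex as well, with \<open>w\<close>
      exceptional in its row; as \<open>b l w\<close> is nonzero, tightness makes \<open>x w\<close>
      vanish.\<close>
    have xw: "x w = 0" using max_row(1)[OF l(1) xl w(1) lw[symmetric] le] blw by simp
    note L = max_row(2)[OF l(1) xl w(1) lw[symmetric] le]
    \<comment> \<open>Row \<open>w\<close> weighted by \<open>x\<close> sums to 0 and has a negative
      term at \<open>l\<close>, so some term is positive.\<close>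
    have "\<exists>m<n. b w m = 1"
    proof (rule ccontr)
      assume no: "\<not> ?thesis"
      have "(\<Sum>m<n. real_of_int (b w m) * x m) < (\<Sum>m<n. 0)"
      proof (rule sum_strict_mono_ex1)
        show "\<forall>m\<in>{..<n}. real_of_int (b w m) * x m \<le> 0"
        proof
          fix m assume "m \<in> {..<n}"
          then show "real_of_int (b w m) * x m \<le> 0"
            using no x(1)[of m] by (cases rule: b_cases[of w m]) auto
        qed
        show "\<exists>m\<in>{..<n}. real_of_int (b w m) * x m < 0" using l xl by (intro bexI[of _ l]) auto
      qed simp
      then show False using eig[OF w(1)] xw by (simp add: mulv_def)
    qed
    then obtain m where m: "m < n" "b w m = 1" by blast
    then have "m \<noteq> l" "m \<noteq> w" using l b_diag by auto
    then have "b w l * b l m * b m w = -1" using L m l b_sym[of m w] by simp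
    then show ?thesis using w l m by blast
  qed
qed

end

section \<open>Passage to a nonnegative eigenvector, and the conclusion\<close>

lemma nonneg_switching:
  assumes n: "n > 0" and sg: "signed_graph n sg"
  obtains s x where "\<And>i. s i = 1 \<or> s i = (-1::int)"
    and "\<And>i. i < n \<Longrightarrow> 0 \<le> x i" and "\<And>i. i < n \<Longrightarrow> x i \<le> 1" and "\<exists>u<n. x u = 1"
    and "\<And>i. i < n \<Longrightarrow> mulv n (\<lambda>i j. s i * s j * sg i j) x i = index n sg * x i"
proof -
  have "sg i j = sg j i" for i j using sg by (simp add: signed_graph_def)
  then obtain y where y: "\<exists>i<n. y i \<noteq> 0" "\<forall>i<n. mulv n sg y i = index n sg * y i"
    using index_eigenvector[OF n, of sg] by blast
  define m where "m = Max ((\<lambda>i. \<bar>y i\<bar>) ` {..<n})"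
  have le: "\<bar>y i\<bar> \<le> m" if "i < n" for i unfolding m_def using that by (intro Max_ge) auto
  have "m \<in> (\<lambda>i. \<bar>y i\<bar>) ` {..<n}" unfolding m_def using n by (intro Max_in) auto
  then obtain u where u: "u < n" "\<bar>y u\<bar> = m" by auto
  have m: "m > 0" using y(1) le by force
  \<comment> \<open>Switching at the negative entries replaces \<open>y\<close> by its absolute
    value; dividing by \<open>m\<close> makes the largest entry 1.\<close>
  define s where "s i = (if y i < 0 then -1 else (1::int))" for i
  define x where "x i = \<bar>y i\<bar> / m" for i
  have sx: "real_of_int (s i) * x i = y i / m" for i by (simp add: s_def x_def)
  have xs: "x i = real_of_int (s i) * (y i / m)" for i by (simp add: s_def x_def)
  have "mulv n (\<lambda>i j. s i * s j * sg i j) x i = index n sg * x i" if "i < n" for i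
  proof -
    have "mulv n (\<lambda>i j. s i * s j * sg i j) x i
        = (\<Sum>j<n. real_of_int (s i) * (real_of_int (sg i j) * (real_of_int (s j) * x j)))"
      by (simp add: mulv_def ac_simps)
    also have "\<dots> = real_of_int (s i) * (mulv n sg y i / m)"
      by (simp add: sx mulv_def sum_distrib_left sum_divide_distrib)
    also have "\<dots> = index n sg * x i" using y(2) that by (simp add: xs)
    finally show ?thesis .
  qed
  moreover have "s i = 1 \<or> s i = -1" for i by (simp add: s_def)
  moreover have "x u = 1" using u m by (simp add: x_def)
  moreover have "x i \<le> 1" if "i < n" for i using le[OF that] m by (simp add: x_def)
  moreover have "0 \<le> x i" for i using m by (simp add: x_def)
  ultimately show thesis using that u(1) by blast
qed

theorem theorem1p8:
  fixes r n :: nat and sg :: "nat \<Rightarrow> nat \<Rightarrow> int"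
  assumes "r \<ge> 3" and "n \<ge> r"
    and "signed_graph n sg"
    and "unbalanced n sg"
    and "Kminus_free (r + 1) n sg"
  shows "index n sg \<le> index n (Gamma1 n r)
         \<and> (index n sg = index n (Gamma1 n r) \<longleftrightarrow> switching_equivalent n sg (Gamma1 n r))"
proof -
  have n: "n > 0" using assms(1,2) by simp
  have sg_sym: "sg i j = sg j i" for i j using assms(3) by (simp add: signed_graph_def)
  have equiv: "index n sg = index n (Gamma1 n r)" if "switching_equivalent n sg (Gamma1 n r)"
    using index_switching_equivalent[OF n sg_sym Gamma1_sym that] .
  obtain s x where s: "\<And>i. s i = 1 \<or> s i = (-1::int)"
    and x: "\<And>i. i < n \<Longrightarrow> 0 \<le> x i" "\<And>i. i < n \<Longrightarrow> x i \<le> 1" "\<exists>u<n. x u = 1"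
    and eig: "\<And>i. i < n \<Longrightarrow> mulv n (\<lambda>i j. s i * s j * sg i j) x i = index n sg * x i"
    using nonneg_switching[OF n assms(3)] by blast
  define b where "b i j = s i * s j * sg i j" for i j
  have b: "signed_graph n b"
    unfolding signed_graph_def
  proof (intro conjI allI impI)
    fix i j
    have "sg i j \<in> {-1, 0, 1}" using assms(3) by (simp add: signed_graph_def)
    then show "b i j \<in> {-1, 0, 1}" using s[of i] s[of j] by (auto simp: b_def)
    show "b i j = b j i" using sg_sym[of i j] by (simp add: b_def)
  qed (use assms(3) in \<open>auto simp: b_def signed_graph_def\<close>)
  have eig: "mulv n b x i = index n sg * x i" if "i < n" for i
    using eig[OF that] by (simp add: b_def[abs_def])
  have sg_b: "sg i j = s i * s j * b i j" for i j
    using s[of i] s[of j] by (auto simp: b_def)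
  \<comment> \<open>Adjacency and triangle signs are switching invariants, so the clique bound
    carries over to \<open>b\<close>.\<close>
  have b0: "b i j \<noteq> 0 \<longleftrightarrow> sg i j \<noteq> 0" for i j
    using s[of i] s[of j] by (auto simp: b_def)
  have tri: "b u v * b v w * b w u = sg u v * sg v w * sg w u" for u v w
    using s[of u] s[of v] s[of w] by (auto simp: b_def)
  have free: "card C \<le> r"
    if "C \<subseteq> {..<n}" "\<And>i j. i \<in> C \<Longrightarrow> j \<in> C \<Longrightarrow> i \<noteq> j \<Longrightarrow> b i j \<noteq> 0" "{u, v, w} \<subseteq> C"
      "b u v * b v w * b w u = -1" for C u v w
    using Kminus_free_clique_card[OF assms(3,5,1) that(1) _ that(3)] that(2,4) by (simp add: b0 tri)
  show ?thesis
  proof (cases "index n sg < real n - 2")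
    case True
    \<comment> \<open>The inequality is strict here, and switching equivalence would force equal
      indices.\<close>
    then show ?thesis using Gamma1_index_ge[OF assms(1,2)] equiv by auto
  next
    case False
    then have large: "real n - 2 \<le> index n sg" by simp
    interpret li: large_index n b x "index n sg"
      by (rule large_index.intro[OF b x(1,2) eig large])
    obtain u0 where u0: "u0 < n" "x u0 = 1" using x(3) by blast
    have "\<exists>i<n. \<exists>j<n. b i j = -1"
      unfolding b_def by (rule unbalanced_negative_edge[OF assms(3,4) s])
    then obtain i j where "i < n" "j < n" "b i j = -1" by blast
    then obtain a d e where tri: "a < n" "d < n" "e < n" "b a d * b d e * b e a = -1"
      using li.negative_triangle_exists[OF u0] by blast
    have "\<exists>C D c u v w p q. maximal_clique n r b x C D c u v w p q"
    proof (rule maximal_clique_exists[OF b x(1) assms(2) _ tri])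
      fix C u v w
      assume "C \<subseteq> {..<n}" "\<And>i j. i \<in> C \<Longrightarrow> j \<in> C \<Longrightarrow> i \<noteq> j \<Longrightarrow> b i j \<noteq> 0"
        "{u, v, w} \<subseteq> C" "b u v * b v w * b w u = -1"
      then show "card C \<le> r" by (rule free)
    qed
    then obtain C D c u v w p q where "maximal_clique n r b x C D c u v w p q" by blast
    then interpret mc: maximal_clique n r b x C D c u v w p q .
    let ?S = "star n p q D"
    have "p \<in> D" "q \<in> D" "p \<noteq> q" using mc.p(1) mc.q_C mc.CD(1) mc.q(2) by auto
    then obtain \<pi> where \<pi>: "\<pi> permutes {0..<n}"
      "\<forall>i<n. \<forall>j<n. ?S i j = Gamma1 n r (\<pi> i) (\<pi> j)"
      using star_Gamma1[OF mc.CD(2,3)] by blast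
    then have "switching_equivalent n ?S (Gamma1 n r)"
      unfolding switching_equivalent_def by (intro exI[of _ \<pi>] exI[of _ "{}"]) simp
    then have star_index: "index n ?S = index n (Gamma1 n r)"
      by (rule index_switching_equivalent[OF n star_sym Gamma1_sym])
    have pos: "nsq n x > 0" using u0 nsq_nonneg[of n x] nsq_eq_0_iff[of n x] by force
    have quad_b: "quad n b x = index n sg * nsq n x" by (rule quad_eigen[OF eig])
    have star_le: "quad n ?S y \<le> index n ?S * nsq n y" for y
      using quad_le_index[OF n star_sym] .
    have "index n sg * nsq n x \<le> index n ?S * nsq n x"
      using mc.quad_le_star star_le[of x] quad_b by linarith
    then have le: "index n sg \<le> index n (Gamma1 n r)" using pos star_index by simp
    moreover have "switching_equivalent n sg (Gamma1 n r)" if eq: "index n sg = index n (Gamma1 n r)"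
    proof -
      \<comment> \<open>Equal indices make the whole chain tight, so \<open>x\<close> attains the
        Rayleigh bound of the star and is an eigenvector of it too.\<close>
      have "quad n ?S x = index n sg * nsq n x"
        using mc.quad_le_star star_le[of x] quad_b eq star_index by (simp add: antisym)
      then have star_eig: "mulv n ?S x i = index n sg * x i" if "i < n" for i
        using eigen_if_maximal[of ?S n "index n sg" x i, OF star_sym _ _ that] star_le eq star_index
        by simp
      have "b i j = ?S i j" if ij: "i < n" "j < n" for i j
      proof (cases "\<exists>z<n. x z = 0")
        case False
        then have "0 < x i" if "i < n" for i using x(1)[OF that] that by (simp add: less_le) metis
        then show ?thesis using mc.eq_star_if_pos[OF _ eig star_eig ij] by blast
      next
        case True
        then obtain z where z: "z < n" "x z = 0" by blast
        note zero = li.zero_entry[OF u0 z]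
        \<comment> \<open>All edges avoiding \<open>z\<close> are positive, so the negative edge
          ends at \<open>z\<close>. Hence \<open>z\<close> lies in \<open>C\<close>, and as all
          other entries are 1, the minimiser \<open>p\<close> is \<open>z\<close>.\<close>
        have "z \<in> {v, w}"
          using zero(2)[of v w] mc.vw mc.triangle_distinct mc.C_lt mc.triangle by fastforce
        then have "x p \<le> 0" using mc.p(2)[of z] mc.triangle z by auto
        then have pz: "p = z" using zero(1)[of p] mc.C_lt[OF mc.p(1)] by fastforce
        then have "p < n" "x p = 0" using z by auto
        then show ?thesis
          using mc.eq_star_if_zero[OF _ _ _ star_eig ij] zero unfolding pz by blast
      qed
      then have "sg i j = s i * s j * Gamma1 n r (\<pi> i) (\<pi> j)" if "i < n" "j < n" for i j
        using sg_b[of i j] \<pi>(2) that by simp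
      \<comment> \<open>The graphs were identified after switching; undoing this uses the set where
        \<open>s\<close> is -1.\<close>
      moreover have "s i * s j = (if (i \<in> {i. i < n \<and> s i = -1}) = (j \<in> {i. i < n \<and> s i = -1}) then 1 else -1)"
        if "i < n" "j < n" for i j using s[of i] s[of j] that by auto
      ultimately show ?thesis
        unfolding switching_equivalent_def using \<pi>(1)
        by (intro exI[of _ \<pi>] exI[of _ "{i. i < n \<and> s i = -1}"]) auto
    qed
    ultimately show ?thesis using equiv by blast
  qed
qed

end
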